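(* Let $N,D_x,D_y\ge 1$, let $\boldsymbol{\Sigma}_{x_ny}\in\mathbb{R}^{D_x\times D_y}$ and $h_n\in\mathbb{R}\setminus\{0\}$ for $n=1,\dots,N$, let $E>0$, and put $\mathbf{M}_n=\boldsymbol{\Sigma}_{x_ny}^\top\boldsymbol{\Sigma}_{x_ny}$. Consider the problem $$\min_{\mathbf{G}}\ \sum_{n=1}^N\operatorname{Tr}\big(h_n^{-2}\mathbf{M}_n(\mathbf{G}^\top\mathbf{G}+h_n^{-2}\mathbf{I})^{-1}\big)\quad\text{s.t.}\quad\operatorname{Tr}(\mathbf{G}^\top\mathbf{G})\le E\qquad(\ast)$$ over $\mathbf{G}\in\mathbb{R}^{D_y\times D_y}$, and the associated first-order condition with Lagrange multiplier $\beta>0$, $$\sum_{n=1}^N\mathbf{G}(\mathbf{G}^\top\mathbf{G}+h_n^{-2}\mathbf{I})^{-1}h_n^{-2}\mathbf{M}_n(\mathbf{G}^\top\mathbf{G}+h_n^{-2}\mathbf{I})^{-1}=\beta\mathbf{G}.\qquad(\ast\ast)$$ Let $\mathcal{S}$ be the set of (orthonormal) eigenvectors of $\sum_{n=1}^N\mathbf{M}_n$ corresponding to positive eigenvalues, and $\mathcal{S}_n$ the set of (orthonormal) eigenvectors of $\mathbf{M}_n$ corresponding to positive eigenvalues, in the sense fixed in the context. Suppose $\mathcal{S}_n\subseteq\mathcal{S}$ for all $n=1,\dots,N$. Let $\mathbf{P}=(\mathbf{p}_1,\dots,\mathbf{p}_{D_y})$ be an orthogonal matrix whose columns are eigenvectors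 of $\sum_{n=1}^N\mathbf{M}_n$ and include all elements of $\mathcal{S}$. Then there exist $\beta>0$ and a diagonal matrix $\mathbf{W}=\operatorname{diag}(w_1,\dots,w_{D_y})$ with all $w_d\ge 0$ such that $\mathbf{G}=\sqrt{\mathbf{W}}\,\mathbf{P}^\top$ is a solution of $(\ast\ast)$ and is (at least) a local optimum, i.e. a feasible local minimizer, of $(\ast)$.
   Context: Here $\mathcal{S}$ denotes an orthonormal set of eigenvectors of $\sum_{n=1}^N\mathbf{M}_n$ with positive eigenvalues, forming a basis of the sum of all eigenspaces of $\sum_{n=1}^N\mathbf{M}_n$ with positive eigenvalue; $\mathcal{S}_n$ denotes likewise an orthonormal set of eigenvectors of $\mathbf{M}_n$ with positive eigenvalues, forming a basis of the sum of all eigenspaces of $\mathbf{M}_n$ with positive eigenvalue. $\sqrt{\mathbf{W}}=\operatorname{diag}(\sqrt{w_1},\dots,\sqrt{w_{D_y}})$. Background: in the multi-user Gaussian linear model, user $n$ wants to estimate $\mathbf{x}_n\in\mathbb{R}^{D_x}$, jointly Gaussian with the source $\mathbf{y}\in\mathbb{R}^{D_y}$ (covariance of $\mathbf{y}$ equal to $\mathbf{I}$, cross-covariance $\boldsymbol{\Sigma}_{x_ny}$), from $\mathbf{r}_n=h_n\mathbf{G}\mathbf{y}+\mathbf{u}_n$ with $\mathbf{u}_n\sim\mathcal{N}(\mathbf{0},\mathbf{I})$; up to an additive constant the objective of $(\ast)$ is the sum over users of the mean squared errors under optimal linear estimation. *)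

theory Defs
  imports "HOL-Analysis.Analysis"
begin

definition eigenspace :: "real^'d^'d \<Rightarrow> real \<Rightarrow> (real^'d) set" where
  "eigenspace A \<mu> = {v. A *v v = \<mu> *\<^sub>R v}"

definition eigenvector :: "real^'d^'d \<Rightarrow> real \<Rightarrow> real^'d \<Rightarrow> bool" where
  "eigenvector A \<mu> v \<longleftrightarrow> v \<noteq> 0 \<and> v \<in> eigenspace A \<mu>"

(* The sum of the eigenspaces for positive eigenvalues is the span of their union;
   it is {0} if there is no positive eigenvalue, and then S is empty. *)
definition positive_eigenbasis :: "real^'d^'d \<Rightarrow> (real^'d) set \<Rightarrow> bool" where
  "positive_eigenbasis A S \<longleftrightarrow>
     pairwise orthogonal S \<and> (\<forall>v\<in>S. norm v = 1) \<and>
     (\<forall>v\<in>S. \<exists>\<mu>>0. eigenvector A \<mu> v) \<and>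
     independent S \<and> span S = span (\<Union>\<mu>\<in>{0<..}. eigenspace A \<mu>)"

definition diag_matrix :: "real^'d \<Rightarrow> real^'d^'d" where
  "diag_matrix w = (\<chi> i j. if i = j then w $ i else 0)"

definition sqrt_diag_matrix :: "real^'d \<Rightarrow> real^'d^'d" where
  "sqrt_diag_matrix w = diag_matrix (\<chi> i. sqrt (w $ i))"

definition gram :: "real^'y^'x \<Rightarrow> real^'y^'y" where
  "gram \<Sigma> = transpose \<Sigma> ** \<Sigma>"

(* (G\<^sup>T G + c\<^sup>-\<^sup>2 I)\<^sup>-\<^sup>1 for a channel gain c; the inverted matrix is positive definite when
   c \<noteq> 0, so the library inverse is then the true one. *)
definition resolvent :: "real^'y^'y \<Rightarrow> real \<Rightarrow> real^'y^'y" where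
  "resolvent G c = matrix_inv (transpose G ** G + (1 / c\<^sup>2) *\<^sub>R mat 1)"

definition mse_objective ::
    "nat \<Rightarrow> (nat \<Rightarrow> real) \<Rightarrow> (nat \<Rightarrow> real^'y^'x) \<Rightarrow> real^'y^'y \<Rightarrow> real" where
  "mse_objective N h \<Sigma> G =
     (\<Sum>n=1..N. trace (((1 / (h n)\<^sup>2) *\<^sub>R gram (\<Sigma> n)) ** resolvent G (h n)))"

definition feasible_set :: "real \<Rightarrow> (real^'y^'y) set" where
  "feasible_set E = {G. trace (transpose G ** G) \<le> E}"

definition first_order_condition ::
    "nat \<Rightarrow> (nat \<Rightarrow> real) \<Rightarrow> (nat \<Rightarrow> real^'y^'x) \<Rightarrow> real \<Rightarrow> real^'y^'y \<Rightarrow> bool" where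
  "first_order_condition N h \<Sigma> \<beta> G \<longleftrightarrow>
     (\<Sum>n=1..N. G ** resolvent G (h n) ** ((1 / (h n)\<^sup>2) *\<^sub>R gram (\<Sigma> n)) ** resolvent G (h n))
       = \<beta> *\<^sub>R G"

definition local_minimizer_on :: "('a::metric_space \<Rightarrow> real) \<Rightarrow> 'a set \<Rightarrow> 'a \<Rightarrow> bool" where
  "local_minimizer_on f F x \<longleftrightarrow>
     x \<in> F \<and> (\<exists>\<epsilon>>0. \<forall>y\<in>F. dist y x < \<epsilon> \<longrightarrow> f x \<le> f y)"

end

theory Submission
  imports Defs
begin

text \<open>
  The eigenvector hypotheses force the columns of P to diagonalise every M_n simultaneously.
  For a unit vector p, the diagonal entry of the resolvent at p is at least
  1 / (|G p|^2 + h_n^(-2)), with equality when p is an eigenvector of the Gram matrix of G. The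
  objective is therefore bounded below by a separable function of the powers |G p_d|^2, whose sum
  is the trace of the Gram matrix of G, and the bound is attained by the matrices sqrt(W) P^T.
  A minimiser w of this scalar water-filling problem exists on the simplex by compactness and
  yields even a global minimiser; comparing transfers of power between two coordinates gives the
  multiplier. If all M_n vanish, w = 0 works with any multiplier.
\<close>

section \<open>Quadratic forms and eigenvectors\<close>

lemma inner_transpose_matrix:
  fixes A :: "real^'n^'m"
  shows "(transpose A *v x) \<bullet> y = x \<bullet> (A *v y)"
  by (simp add: dot_lmul_matrix)

lemma inner_transpose_matrix_right:
  fixes A :: "real^'n^'m"
  shows "x \<bullet> (transpose A *v y) = (A *v x) \<bullet> y"
  by (metis inner_commute inner_transpose_matrix)

lemma transpose_gram: "transpose (gram A) = gram A"
  by (simp add: gram_def matrix_transpose_mul)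

lemma gram_mult: "gram A *v x = transpose A *v (A *v x)"
  by (simp add: gram_def matrix_vector_mul_assoc)

lemma inner_gram: "x \<bullet> (gram A *v y) = (A *v x) \<bullet> (A *v y)"
  by (simp only: gram_mult inner_transpose_matrix_right)

text \<open>A quadratic in t that is never negative and is 0 at t = 0 has a minimum there, so its
  slope \<open>2 * a\<close> vanishes. This extracts first-order conditions without
  derivatives.\<close>

lemma linear_coefficient_zero:
  fixes a b :: real
  assumes "\<And>t. 0 \<le> 2 * t * a + t\<^sup>2 * b"
  shows "a = 0"
proof (rule ccontr)
  assume "a \<noteq> 0"
  \<comment> \<open>Replacing \<open>b\<close> by the larger, surely positive
    \<open>\<bar>b\<bar> + 1\<close> gives a convex parabola; \<open>t\<close> is its vertex, where
    its value is negative.\<close>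
  define t where "t = - a / (\<bar>b\<bar> + 1)"
  have "2 * t * a + t\<^sup>2 * b \<le> 2 * t * a + t\<^sup>2 * (\<bar>b\<bar> + 1)"
    by (intro add_left_mono mult_left_mono) auto
  also have "\<dots> = - a\<^sup>2 / (\<bar>b\<bar> + 1)"
    unfolding t_def by (simp add: divide_simps power2_eq_square)
  also have "\<dots> < 0"
    using \<open>a \<noteq> 0\<close> by (simp add: divide_neg_pos)
  finally show False
    using assms[of t] by linarith
qed

text \<open>Rayleigh quotient argument: the form
  \<open>\<mu> * (x \<bullet> x) - x \<bullet> (A *v x)\<close> is nonnegative on \<open>T\<close>
  and zero at \<open>u\<close>, so its slope at \<open>u\<close> vanishes in every direction of
  \<open>T\<close>. By invariance the residual \<open>b\<close> of the eigenvector equation is such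
  a direction, and the slope along it is twice its squared norm.\<close>

lemma maximizer_eigenvector:
  fixes A :: "real^'n^'n"
  assumes sym: "transpose A = A" and T: "subspace T"
    and inv: "\<And>x. x \<in> T \<Longrightarrow> A *v x \<in> T"
    and u: "u \<in> T" "norm u = 1"
    and max: "\<And>x. x \<in> T \<Longrightarrow> norm x = 1 \<Longrightarrow> x \<bullet> (A *v x) \<le> u \<bullet> (A *v u)"
  shows "A *v u = (u \<bullet> (A *v u)) *\<^sub>R u"
proof -
  define \<mu> where "\<mu> = u \<bullet> (A *v u)"
  define b where "b = \<mu> *\<^sub>R u - A *v u"
  have symA: "x \<bullet> (A *v y) = y \<bullet> (A *v x)" for x y
    using inner_transpose_matrix[of A x y] sym by (simp add: inner_commute)
  have psd: "0 \<le> \<mu> * (x \<bullet> x) - x \<bullet> (A *v x)" if "x \<in> T" for x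
  proof (cases "x = 0")
    case False
    let ?y = "(1 / norm x) *\<^sub>R x"
    have "?y \<bullet> (A *v ?y) \<le> \<mu>"
      unfolding \<mu>_def using T that False by (intro max) (auto simp: subspace_scale)
    moreover have "?y \<bullet> (A *v ?y) = x \<bullet> (A *v x) / (norm x)\<^sup>2"
      by (simp add: matrix_vector_mult_scaleR power2_eq_square)
    ultimately have "x \<bullet> (A *v x) / (norm x)\<^sup>2 \<le> \<mu>"
      by metis
    then show ?thesis
      using False by (simp add: divide_le_eq power2_norm_eq_inner)
  qed simp
  have bT: "b \<in> T"
    unfolding b_def using T u inv by (simp add: subspace_diff subspace_scale)
  have uu: "u \<bullet> u = 1"
    using u by (simp add: norm_eq_1)
  have "0 \<le> 2 * t * (b \<bullet> b) + t\<^sup>2 * (\<mu> * (b \<bullet> b) - b \<bullet> (A *v b))" for t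
  proof -
    have "0 \<le> \<mu> * ((u + t *\<^sub>R b) \<bullet> (u + t *\<^sub>R b)) - (u + t *\<^sub>R b) \<bullet> (A *v (u + t *\<^sub>R b))"
      using T u bT by (intro psd) (simp add: subspace_add subspace_scale)
    also have "\<dots> = 2 * t * (\<mu> * (b \<bullet> u) - b \<bullet> (A *v u)) + t\<^sup>2 * (\<mu> * (b \<bullet> b) - b \<bullet> (A *v b))"
      using uu symA[of u b] by (simp add: inner_add inner_commute[of u b] matrix_vector_right_distrib
          matrix_vector_mult_scaleR \<mu>_def[symmetric] power2_eq_square algebra_simps)
    also have "\<mu> * (b \<bullet> u) - b \<bullet> (A *v u) = b \<bullet> b"
      by (simp add: b_def inner_diff_right inner_diff_left)
    finally show ?thesis .
  qed
  then have "b \<bullet> b = 0"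
    by (rule linear_coefficient_zero)
  then show ?thesis
    by (simp add: b_def \<mu>_def)
qed

text \<open>Takes the place of a full spectral decomposition. The orthogonal complement
  \<open>T\<close> of \<open>S\<close> is invariant under \<open>A\<close>. A positive value of the
  form on \<open>T\<close> would make a maximizer on the unit sphere of \<open>T\<close> an
  eigenvector with positive eigenvalue, which lies both in \<open>span S\<close> and in its
  complement.\<close>

lemma positive_eigenbasis_orthogonal_nonpos:
  fixes A :: "real^'n^'n"
  assumes sym: "transpose A = A" and S: "positive_eigenbasis A S"
    and v: "\<And>s. s \<in> S \<Longrightarrow> orthogonal s v"
  shows "v \<bullet> (A *v v) \<le> 0"
proof (rule ccontr)
  assume "\<not> v \<bullet> (A *v v) \<le> 0"
  then have pos: "v \<bullet> (A *v v) > 0" and "v \<noteq> 0"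
    by auto
  define T where "T = {x. \<forall>s\<in>S. orthogonal s x}"
  have T: "subspace T"
    by (auto simp: subspace_def T_def orthogonal_clauses)
  have inv: "A *v x \<in> T" if "x \<in> T" for x
  proof -
    have "s \<bullet> (A *v x) = 0" if "s \<in> S" for s
    proof -
      obtain \<mu> where "A *v s = \<mu> *\<^sub>R s"
        using S \<open>s \<in> S\<close> by (auto simp: positive_eigenbasis_def eigenvector_def eigenspace_def)
      moreover have "s \<bullet> (A *v x) = (A *v s) \<bullet> x"
        using inner_transpose_matrix[of A s x] sym by simp
      ultimately show ?thesis
        using \<open>x \<in> T\<close> \<open>s \<in> S\<close> by (simp add: T_def orthogonal_def)
    qed
    then show ?thesis
      by (simp add: T_def orthogonal_def)
  qed
  have "compact (sphere 0 1 \<inter> T)"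
    by (simp add: T closed_subspace compact_Int_closed)
  \<comment> \<open>The normalised \<open>v\<close> shows that the sphere in \<open>T\<close> is
    nonempty, and later that the maximum is positive.\<close>
  moreover have v1: "(1 / norm v) *\<^sub>R v \<in> sphere 0 1 \<inter> T"
    using v \<open>v \<noteq> 0\<close> by (simp add: T_def orthogonal_clauses)
  moreover have "continuous_on (sphere 0 1 \<inter> T) (\<lambda>x. x \<bullet> (A *v x))"
    by (intro continuous_intros linear_continuous_on linear_linear[THEN iffD2] matrix_vector_mul_linear)
  ultimately have "\<exists>u\<in>sphere 0 1 \<inter> T. \<forall>x\<in>sphere 0 1 \<inter> T. x \<bullet> (A *v x) \<le> u \<bullet> (A *v u)"
    by (intro continuous_attains_sup) blast+
  then obtain u where u: "u \<in> sphere 0 1 \<inter> T"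
    and max: "\<And>x. x \<in> sphere 0 1 \<inter> T \<Longrightarrow> x \<bullet> (A *v x) \<le> u \<bullet> (A *v u)"
    by blast
  have "0 < v \<bullet> (A *v v) / (norm v)\<^sup>2"
    using pos \<open>v \<noteq> 0\<close> by simp
  also have "\<dots> \<le> u \<bullet> (A *v u)"
    using max[OF v1] by (simp add: matrix_vector_mult_scaleR power2_eq_square)
  finally have \<mu>: "u \<bullet> (A *v u) > 0" .
  have "A *v u = (u \<bullet> (A *v u)) *\<^sub>R u"
    using sym T inv u max by (intro maximizer_eigenvector[where T = T]) auto
  then have "u \<in> (\<Union>\<mu>\<in>{0<..}. eigenspace A \<mu>)"
    using \<mu> by (auto simp: eigenspace_def)
  then have "u \<in> span S"
    using S by (metis positive_eigenbasis_def span_base)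
  then have "orthogonal u u"
    using u by (intro orthogonal_to_span[of u S u]) (auto simp: T_def orthogonal_commute)
  then show False
    using u by (auto simp: orthogonal_self)
qed

text \<open>A column outside \<open>S\<close> is orthogonal to every element of \<open>S\<close>,
  since these are other columns of \<open>P\<close>. The form of \<open>gram A\<close> at it is then
  at most 0, but it equals the squared norm of its image under \<open>A\<close>, so the column lies
  in the kernel and has eigenvalue 0.\<close>

lemma gram_column_eigenvector:
  fixes A :: "real^'y^'x" and P :: "real^'y^'y"
  assumes S: "positive_eigenbasis (gram A) S" and "S \<subseteq> columns P" and P: "orthogonal_matrix P"
  shows "\<exists>l\<ge>0. gram A *v column d P = l *\<^sub>R column d P"
proof (cases "column d P \<in> S")
  case True
  then show ?thesis
    using S by (auto simp: positive_eigenbasis_def eigenvector_def eigenspace_def intro: less_imp_le)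
next
  case False
  have "orthogonal s (column d P)" if s: "s \<in> S" for s
  proof -
    obtain e where "s = column e P"
      using s \<open>S \<subseteq> columns P\<close> by (auto simp: columns_def)
    moreover have "e \<noteq> d"
      using calculation s False by blast
    ultimately show ?thesis
      using P by (simp add: orthogonal_matrix_orthonormal_columns)
  qed
  then have "column d P \<bullet> (gram A *v column d P) \<le> 0"
    using positive_eigenbasis_orthogonal_nonpos[OF transpose_gram S] by blast
  then have "A *v column d P = 0"
    by (metis inner_gram inner_eq_zero_iff inner_ge_zero order_antisym)
  then have "gram A *v column d P = 0"
    by (simp only: gram_mult matrix_vector_mult_0_right)
  then show ?thesis
    by (intro exI[of _ 0]) simp
qed

section \<open>Orthonormal columns\<close>

lemma orthogonal_matrix_inner_columns:
  fixes P :: "real^'n^'n"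
  assumes "orthogonal_matrix P"
  shows "column d P \<bullet> column e P = (if d = e then 1 else 0)"
  using assms by (auto simp: orthogonal_matrix_orthonormal_columns norm_eq_1 orthogonal_def)

lemma column_matrix_mult:
  fixes A :: "real^'n^'m"
  shows "column d (A ** B) = A *v column d B"
  by (simp add: vec_eq_iff column_def matrix_matrix_mult_def matrix_vector_mult_def)

lemma trace_orthonormal_columns:
  fixes A P :: "real^'n^'n"
  assumes "orthogonal_matrix P"
  shows "trace A = (\<Sum>d\<in>UNIV. column d P \<bullet> (A *v column d P))"
proof -
  have "trace A = trace ((A ** P) ** transpose P)"
    using assms by (simp add: matrix_mul_assoc[symmetric] orthogonal_matrix_def)
  also have "\<dots> = trace (transpose P ** (A ** P))"
    by (rule trace_mul_sym)
  also have "\<dots> = (\<Sum>d\<in>UNIV. column d P \<bullet> column d (A ** P))"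
    by (simp add: trace_def matrix_matrix_mult_def transpose_def inner_vec_def column_def)
  finally show ?thesis
    by (simp add: column_matrix_mult)
qed

lemma matrix_eqI_columns:
  fixes A B :: "real^'n^'m" and P :: "real^'n^'n"
  assumes P: "orthogonal_matrix P" and "\<And>d. A *v column d P = B *v column d P"
  shows "A = B"
proof -
  have "column d (A ** P) = column d (B ** P)" for d
    by (simp add: column_matrix_mult assms(2))
  then have "A ** P = B ** P"
    by (simp add: vec_eq_iff column_def)
  then have "(A ** P) ** transpose P = (B ** P) ** transpose P"
    by simp
  then show ?thesis
    using P by (simp add: matrix_mul_assoc[symmetric] orthogonal_matrix_def)
qed

lemma sqrt_diag_matrix_axis: "sqrt_diag_matrix w *v axis d 1 = sqrt (w $ d) *\<^sub>R axis d 1"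
  unfolding matrix_vector_mult_basis
  by (simp add: vec_eq_iff column_def sqrt_diag_matrix_def diag_matrix_def axis_def)

lemma sqrt_diag_transpose_column:
  fixes P :: "real^'n^'n"
  assumes "orthogonal_matrix P"
  shows "(sqrt_diag_matrix w ** transpose P) *v column d P = sqrt (w $ d) *\<^sub>R axis d 1"
proof -
  have "transpose P *v column d P = axis d 1"
    using assms matrix_vector_mult_basis[of P d]
    by (metis matrix_vector_mul_assoc matrix_vector_mul_lid orthogonal_matrix_def)
  then show ?thesis
    by (metis matrix_vector_mul_assoc sqrt_diag_matrix_axis)
qed

text \<open>For nonnegative \<open>w\<close> the Gram matrix is P diag(w) P^T, so
  \<open>w $ d\<close> is exactly the power spent on column \<open>d\<close>.\<close>

lemma gram_sqrt_diag_column: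
  fixes P :: "real^'n^'n"
  assumes P: "orthogonal_matrix P" and w: "w $ d \<ge> 0"
  shows "gram (sqrt_diag_matrix w ** transpose P) *v column d P = (w $ d) *\<^sub>R column d P"
proof -
  have "transpose (sqrt_diag_matrix w) = sqrt_diag_matrix w"
    by (auto simp: sqrt_diag_matrix_def diag_matrix_def transpose_def vec_eq_iff)
  then have "gram (sqrt_diag_matrix w ** transpose P) *v column d P
      = P *v (sqrt_diag_matrix w *v (sqrt (w $ d) *\<^sub>R axis d 1))"
    unfolding gram_mult sqrt_diag_transpose_column[OF P]
    by (simp only: matrix_transpose_mul transpose_transpose matrix_vector_mul_assoc)
  also have "sqrt_diag_matrix w *v (sqrt (w $ d) *\<^sub>R axis d 1) = (w $ d) *\<^sub>R axis d 1"
    using w by (simp add: matrix_vector_mult_scaleR sqrt_diag_matrix_axis)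
  finally show ?thesis
    by (simp add: matrix_vector_mult_scaleR matrix_vector_mult_basis)
qed

section \<open>The resolvent\<close>

lemma shifted_gram_mult:
  fixes G :: "real^'n^'n"
  shows "(transpose G ** G + a *\<^sub>R mat 1) *v x = gram G *v x + a *\<^sub>R x"
  by (simp add: gram_def matrix_vector_mult_add_rdistrib scaleR_matrix_vector_assoc[symmetric])

text \<open>The shifted Gram matrix is positive definite, hence has trivial kernel and, being
  square, a two-sided inverse. Once one exists, the choice made in \<open>matrix_inv\<close> is
  known to be such an inverse.\<close>

lemma resolvent_inverse:
  fixes G :: "real^'n^'n"
  assumes "c \<noteq> 0"
  shows "resolvent G c *v (gram G *v x + (1 / c\<^sup>2) *\<^sub>R x) = x"
    and "gram G *v (resolvent G c *v x) + (1 / c\<^sup>2) *\<^sub>R (resolvent G c *v x) = x"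
proof -
  let ?B = "transpose G ** G + (1 / c\<^sup>2) *\<^sub>R mat 1"
  have "x = 0" if "?B *v x = 0" for x
  proof -
    have "0 = x \<bullet> (?B *v x)"
      using that by simp
    also have "\<dots> = (norm (G *v x))\<^sup>2 + (1 / c\<^sup>2) * (norm x)\<^sup>2"
      by (simp only: shifted_gram_mult inner_add_right inner_gram power2_norm_eq_inner inner_scaleR_right)
    finally have "(1 / c\<^sup>2) * (norm x)\<^sup>2 \<le> 0"
      by (metis add.commute add_le_same_cancel1 le_add_same_cancel1 zero_le_power2)
    then show ?thesis
      using assms by (simp add: divide_le_0_iff mult_le_0_iff)
  qed
  then obtain B' where "B' ** ?B = mat 1"
    using matrix_left_invertible_ker by blast
  then have "\<exists>B'. ?B ** B' = mat 1 \<and> B' ** ?B = mat 1"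
    using matrix_left_right_inverse by blast
  then have "?B ** resolvent G c = mat 1 \<and> resolvent G c ** ?B = mat 1"
    unfolding resolvent_def matrix_inv_def by (rule someI_ex)
  then show "resolvent G c *v (gram G *v x + (1 / c\<^sup>2) *\<^sub>R x) = x"
    and "gram G *v (resolvent G c *v x) + (1 / c\<^sup>2) *\<^sub>R (resolvent G c *v x) = x"
    by (metis matrix_vector_mul_assoc matrix_vector_mul_lid shifted_gram_mult)+
qed

lemma resolvent_eigenvector:
  fixes G :: "real^'n^'n"
  assumes "c \<noteq> 0" and "w \<ge> 0" and "gram G *v p = w *\<^sub>R p"
  shows "resolvent G c *v p = (1 / (w + 1 / c\<^sup>2)) *\<^sub>R p"
proof -
  have pos: "w + 1 / c\<^sup>2 > 0"
    using assms by (simp add: add_nonneg_pos)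
  have "p = (w + 1 / c\<^sup>2) *\<^sub>R (resolvent G c *v p)"
    using resolvent_inverse(1)[OF assms(1), of G p] assms(3)
    by (simp add: scaleR_left_distrib[symmetric] matrix_vector_mult_scaleR)
  then have "(1 / (w + 1 / c\<^sup>2)) *\<^sub>R p = (1 / (w + 1 / c\<^sup>2)) *\<^sub>R (w + 1 / c\<^sup>2) *\<^sub>R (resolvent G c *v p)"
    by simp
  then show ?thesis
    using pos by simp
qed

text \<open>Expands the nonnegative form of the shifted Gram matrix at x - t p, where x is the resolvent
  applied to p and t is the claimed bound.\<close>

lemma inner_resolvent_ge:
  fixes G :: "real^'n^'n"
  assumes "c \<noteq> 0" and "norm p = 1"
  shows "p \<bullet> (resolvent G c *v p) \<ge> 1 / ((norm (G *v p))\<^sup>2 + 1 / c\<^sup>2)"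
proof -
  define x where "x = resolvent G c *v p"
  define s where "s = (norm (G *v p))\<^sup>2 + 1 / c\<^sup>2"
  define t where "t = 1 / s"
  have s: "s > 0"
    unfolding s_def using assms by (simp add: add_nonneg_pos)
  have pp: "p \<bullet> p = 1"
    using assms by (simp add: norm_eq_1)
  \<comment> \<open>The equation defining \<open>x\<close> in weak form. Tested with
    \<open>x\<close> and with \<open>p\<close>, it evaluates the pure and the mixed terms of the
    expansion below.\<close>
  have Bx: "y \<bullet> p = (G *v y) \<bullet> (G *v x) + (1 / c\<^sup>2) * (y \<bullet> x)" for y
  proof -
    have "y \<bullet> p = y \<bullet> (gram G *v x + (1 / c\<^sup>2) *\<^sub>R x)"
      using resolvent_inverse(2)[OF assms(1), of G p] by (simp add: x_def)
    then show ?thesis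
      by (simp only: inner_add_right inner_gram inner_scaleR_right)
  qed
  let ?y = "x - t *\<^sub>R p"
  have "0 \<le> (G *v ?y) \<bullet> (G *v ?y) + (1 / c\<^sup>2) * (?y \<bullet> ?y)"
    by simp
  also have "\<dots> = x \<bullet> p - 2 * t * (p \<bullet> p) + t\<^sup>2 * s"
    unfolding Bx[of x] Bx[of p] s_def power2_norm_eq_inner using pp
    by (simp add: matrix_vector_mult_diff_distrib matrix_vector_mult_scaleR inner_diff
        inner_commute power2_eq_square algebra_simps)
  also have "\<dots> = x \<bullet> p - t"
    using s by (simp add: pp t_def power2_eq_square)
  finally show ?thesis
    by (simp add: t_def s_def x_def inner_commute)
qed

section \<open>The scalar water-filling problem\<close>

lemma compact_simplex: "compact {w :: real^'d. (\<forall>d. w $ d \<ge> 0) \<and> (\<Sum>d\<in>UNIV. w $ d) = E}"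
  (is "compact ?K")
proof -
  have "?K = (\<Inter>d. {w. w $ d \<ge> 0}) \<inter> {w. (\<Sum>d\<in>UNIV. w $ d) = E}"
    by auto
  moreover have "closed \<dots>"
    by (intro closed_Int closed_INT ballI closed_Collect_le closed_Collect_eq continuous_intros)
  moreover have "bounded ?K"
  proof -
    have "norm w \<le> E" if "w \<in> ?K" for w :: "real^'d"
      using that norm_le_l1_cart[of w] by simp
    then show ?thesis
      unfolding bounded_iff by blast
  qed
  ultimately show ?thesis
    by (simp add: compact_eq_bounded_closed)
qed

text \<open>Here \<open>\<phi> d\<close> is the marginal gain from power in coordinate
  \<open>d\<close>. At a minimizer, moving a little power out of an active coordinate cannot help,
  so active coordinates have the largest marginal gain, and that common value is
  \<open>\<beta>\<close>. As each \<open>g d\<close> is nonincreasing, spending the whole budget is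
  never worse, which extends minimality from the face with sum \<open>E\<close> to sums at most
  \<open>E\<close>.\<close>

lemma separable_minimizer_on_simplex:
  fixes g \<phi> :: "'d::finite \<Rightarrow> real \<Rightarrow> real"
  assumes "E > 0"
    and deriv: "\<And>d x. x \<ge> 0 \<Longrightarrow> (g d has_real_derivative - \<phi> d x) (at x)"
    and \<phi>: "\<And>d x. x \<ge> 0 \<Longrightarrow> \<phi> d x \<ge> 0"
  obtains w :: "real^'d" and \<beta> where "\<forall>d. w $ d \<ge> 0" "(\<Sum>d\<in>UNIV. w $ d) = E"
    "\<forall>d. \<phi> d (w $ d) \<le> \<beta>" "\<forall>d. w $ d > 0 \<longrightarrow> \<phi> d (w $ d) = \<beta>"
    "\<forall>v :: real^'d. (\<forall>d. v $ d \<ge> 0) \<and> (\<Sum>d\<in>UNIV. v $ d) \<le> E \<longrightarrow>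
      (\<Sum>d\<in>UNIV. g d (w $ d)) \<le> (\<Sum>d\<in>UNIV. g d (v $ d))"
proof -
  let ?K = "{w :: real^'d. (\<forall>d. w $ d \<ge> 0) \<and> (\<Sum>d\<in>UNIV. w $ d) = E}"
  let ?F = "\<lambda>w :: real^'d. \<Sum>d\<in>UNIV. g d (w $ d)"
  \<comment> \<open>All power on one arbitrary index shows that the simplex is nonempty.\<close>
  have "axis undefined E \<in> ?K"
    using \<open>E > 0\<close> by (simp add: axis_def)
  then have "?K \<noteq> {}"
    by blast
  moreover have "continuous_on ?K ?F"
  proof (intro continuous_on_sum)
    fix d
    have "continuous_on {0..} (g d)"
      using deriv by (meson atLeast_iff continuous_at_imp_continuous_on DERIV_isCont)
    then show "continuous_on ?K (\<lambda>w. g d (w $ d))"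
      by (rule continuous_on_compose2) (auto intro!: continuous_intros)
  qed
  ultimately have "\<exists>w\<in>?K. \<forall>v\<in>?K. ?F w \<le> ?F v"
    by (rule continuous_attains_inf[OF compact_simplex])
  then obtain w where w: "w \<in> ?K" and min: "\<And>v. v \<in> ?K \<Longrightarrow> ?F w \<le> ?F v"
    by blast
  have transfer: "\<phi> e (w $ e) \<le> \<phi> d (w $ d)" if pos: "w $ d > 0" for d e
  proof (cases "d = e")
    case False
    show ?thesis
    proof (rule ccontr)
      assume less: "\<not> \<phi> e (w $ e) \<le> \<phi> d (w $ d)"
      \<comment> \<open>The two affected terms of the objective when power \<open>t\<close> moves
        from \<open>d\<close> to \<open>e\<close>; a negative slope at 0 would contradict
        minimality.\<close>
      let ?f = "\<lambda>t. g d (w $ d - t) + g e (w $ e + t)"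
      have "(?f has_real_derivative \<phi> d (w $ d) - \<phi> e (w $ e)) (at 0)"
        using w deriv[of "w $ d" d] deriv[of "w $ e" e]
        by (auto intro!: derivative_eq_intros DERIV_chain2[of "g _"])
      then obtain \<delta> where \<delta>: "\<delta> > 0" "\<And>t. 0 < t \<Longrightarrow> t < \<delta> \<Longrightarrow> ?f t < ?f 0"
        using less DERIV_neg_dec_right[of ?f "\<phi> d (w $ d) - \<phi> e (w $ e)" 0] by auto
      \<comment> \<open>Half of \<open>\<delta>\<close> stays strictly inside the range of decrease;
        the cap \<open>w $ d\<close> keeps the reduced coordinate nonnegative.\<close>
      define t where "t = min (\<delta> / 2) (w $ d)"
      have t: "0 < t" "t < \<delta>" "t \<le> w $ d"
        using \<delta> pos by (auto simp: t_def)
      define v where "v = w - t *\<^sub>R axis d 1 + t *\<^sub>R axis e 1"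
      have vd: "v $ d = w $ d - t" and ve: "v $ e = w $ e + t"
        and vo: "\<And>i. i \<noteq> d \<Longrightarrow> i \<noteq> e \<Longrightarrow> v $ i = w $ i"
        using False by (auto simp: v_def axis_def)
      have split: "(\<Sum>i\<in>UNIV. a i) = a d + a e + (\<Sum>i\<in>UNIV - {d, e}. a i)" for a :: "'d \<Rightarrow> real"
        using False sum.subset_diff[of "{d, e}" UNIV a] by simp
      have "v \<in> ?K"
      proof -
        have "v $ i \<ge> 0" for i
          using w t vd ve vo[of i] by (cases "i = d"; cases "i = e") (auto intro: add_nonneg_nonneg)
        moreover have "(\<Sum>i\<in>UNIV. v $ i) = (\<Sum>i\<in>UNIV. w $ i)"
          unfolding split[of "\<lambda>i. v $ i"] split[of "\<lambda>i. w $ i"] by (simp add: vd ve vo)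
        ultimately show ?thesis
          using w by simp
      qed
      moreover have "?F v < ?F w"
        unfolding split[of "\<lambda>i. g i (v $ i)"] split[of "\<lambda>i. g i (w $ i)"]
        using \<delta>(2)[of t] t by (simp add: vd ve vo)
      ultimately show False
        using min by force
    qed
  qed simp
  have "\<exists>d. w $ d > 0"
  proof (rule ccontr)
    assume "\<nexists>d. w $ d > 0"
    then have "(\<Sum>d\<in>UNIV. w $ d) \<le> 0"
      by (intro sum_nonpos) (simp add: not_less)
    then show False
      using w \<open>E > 0\<close> by simp
  qed
  then obtain d0 where d0: "w $ d0 > 0" ..
  have anti: "g d y \<le> g d x" if "0 \<le> x" "x \<le> y" for d x y
    using that(2)
  proof (rule DERIV_nonpos_imp_nonincreasing)
    fix z assume "x \<le> z"
    then have "z \<ge> 0"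
      using that(1) by simp
    then show "\<exists>y. (g d has_real_derivative y) (at z) \<and> y \<le> 0"
      using deriv[of z d] \<phi>[of z d] by (intro exI[of _ "- \<phi> d z"]) simp
  qed
  show ?thesis
  proof
    show "\<forall>d. w $ d \<ge> 0"
      using w by simp
    show "(\<Sum>d\<in>UNIV. w $ d) = E"
      using w by simp
    show "\<forall>d. \<phi> d (w $ d) \<le> \<phi> d0 (w $ d0)"
      using transfer d0 by blast
    show "\<forall>d. w $ d > 0 \<longrightarrow> \<phi> d (w $ d) = \<phi> d0 (w $ d0)"
      using transfer d0 by (blast intro: antisym)
    have "?F w \<le> ?F v" if v: "\<And>d. v $ d \<ge> 0" and sum: "(\<Sum>d\<in>UNIV. v $ d) \<le> E" for v
    proof -
      \<comment> \<open>The unspent budget is added to one coordinate, giving a point of the face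
        that dominates \<open>v\<close> coordinatewise.\<close>
      define v' where "v' = v + (E - (\<Sum>d\<in>UNIV. v $ d)) *\<^sub>R axis d0 1"
      have le: "v $ d \<le> v' $ d" for d
        using sum by (simp add: v'_def axis_def)
      have "(\<Sum>d\<in>UNIV. v' $ d) = E"
        by (simp add: v'_def axis_def sum.distrib if_distrib[of "\<lambda>x. _ * x"] cong: if_cong)
      then have "v' \<in> ?K"
        using v le by (auto intro: order_trans)
      then have "?F w \<le> ?F v'"
        by (rule min)
      also have "\<dots> \<le> ?F v"
        by (intro sum_mono anti v le)
      finally show ?thesis .
    qed
    then show "\<forall>v. (\<forall>d. v $ d \<ge> 0) \<and> (\<Sum>d\<in>UNIV. v $ d) \<le> E \<longrightarrow> ?F w \<le> ?F v"
      by blast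
  qed
qed

lemma water_filling:
  fixes c :: "'n \<Rightarrow> real" and l :: "'n \<Rightarrow> 'd::finite \<Rightarrow> real"
  assumes "finite I" and "E > 0" and c: "\<And>n. n \<in> I \<Longrightarrow> c n > 0" and l: "\<And>n d. n \<in> I \<Longrightarrow> l n d \<ge> 0"
  obtains w :: "real^'d" and \<beta> where "\<beta> > 0" "\<forall>d. w $ d \<ge> 0" "(\<Sum>d\<in>UNIV. w $ d) \<le> E"
    "\<forall>d. w $ d > 0 \<longrightarrow> (\<Sum>n\<in>I. c n * l n d / (w $ d + c n)\<^sup>2) = \<beta>"
    "\<forall>v :: real^'d. (\<forall>d. v $ d \<ge> 0) \<and> (\<Sum>d\<in>UNIV. v $ d) \<le> E \<longrightarrow>
      (\<Sum>n\<in>I. \<Sum>d\<in>UNIV. c n * l n d / (w $ d + c n)) \<le> (\<Sum>n\<in>I. \<Sum>d\<in>UNIV. c n * l n d / (v $ d + c n))"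
proof (cases "\<forall>n\<in>I. \<forall>d. l n d = 0")
  case True
  show ?thesis
    \<comment> \<open>With all eigenvalues zero the objective is constantly 0. At
      \<open>w = 0\<close> no coordinate is active, so the multiplier 1 is an arbitrary positive
      choice.\<close>
    by (rule that[of 1 0]) (use True \<open>E > 0\<close> in auto)
next
  case False
  then obtain m e where m: "m \<in> I" "l m e > 0"
    using l by (metis less_eq_real_def)
  define g where "g d x = (\<Sum>n\<in>I. c n * l n d / (x + c n))" for d x
  define \<phi> where "\<phi> d x = (\<Sum>n\<in>I. c n * l n d / (x + c n)\<^sup>2)" for d x
  have "(g d has_real_derivative - \<phi> d x) (at x)" if "x \<ge> 0" for d x
  proof -
    have "((\<lambda>x. c n * l n d / (x + c n)) has_real_derivative - (c n * l n d / (x + c n)\<^sup>2)) (at x)"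
      if "n \<in> I" for n
      using c[OF that] \<open>x \<ge> 0\<close>
      by (auto intro!: derivative_eq_intros simp: power2_eq_square)
    then show ?thesis
      unfolding g_def \<phi>_def sum_negf[symmetric] by (intro DERIV_sum)
  qed
  moreover have "\<phi> d x \<ge> 0" if "x \<ge> 0" for d x
    unfolding \<phi>_def using c l that by (intro sum_nonneg divide_nonneg_nonneg mult_nonneg_nonneg) (auto intro: less_imp_le)
  ultimately obtain w \<beta> where w: "\<forall>d. w $ d \<ge> 0" "(\<Sum>d\<in>UNIV. w $ d) = E"
    "\<forall>d. \<phi> d (w $ d) \<le> \<beta>" "\<forall>d. w $ d > 0 \<longrightarrow> \<phi> d (w $ d) = \<beta>"
    "\<forall>v :: real^'d. (\<forall>d. v $ d \<ge> 0) \<and> (\<Sum>d\<in>UNIV. v $ d) \<le> E \<longrightarrow>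
      (\<Sum>d\<in>UNIV. g d (w $ d)) \<le> (\<Sum>d\<in>UNIV. g d (v $ d))"
    by (rule separable_minimizer_on_simplex[OF \<open>E > 0\<close>, of g \<phi>]) (assumption | (rule that; assumption))+
  \<comment> \<open>A positive eigenvalue \<open>l m e\<close> makes the marginal gain in coordinate
    \<open>e\<close> positive, and \<open>\<beta>\<close> bounds it from above whether or not that
    coordinate is active.\<close>
  have "0 < \<phi> e (w $ e)"
    unfolding \<phi>_def
  proof (rule sum_pos2[OF \<open>finite I\<close> m(1)])
    have "w $ e + c m > 0"
      using w(1)[rule_format, of e] c[OF m(1)] by simp
    then show "0 < c m * l m e / (w $ e + c m)\<^sup>2"
      using m c by simp
  next
    show "0 \<le> c i * l i e / (w $ e + c i)\<^sup>2" if "i \<in> I" for i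
      using c[OF that] l[OF that, of e] by simp
  qed
  also have "\<dots> \<le> \<beta>"
    using w by blast
  finally show ?thesis
    by (rule that) (use w in \<open>auto simp: g_def \<phi>_def sum.swap[of _ I UNIV]\<close>)
qed

section \<open>Simultaneously diagonalised channels\<close>

lemma mse_objective_eigencolumns:
  fixes P :: "real^'y^'y"
  assumes P: "orthogonal_matrix P"
    and l: "\<And>n d. n \<in> {1..N} \<Longrightarrow> gram (\<Sigma> n) *v column d P = l n d *\<^sub>R column d P"
  shows "mse_objective N h \<Sigma> G =
    (\<Sum>n=1..N. \<Sum>d\<in>UNIV. 1 / (h n)\<^sup>2 * l n d * (column d P \<bullet> (resolvent G (h n) *v column d P)))"
  unfolding mse_objective_def
proof (intro sum.cong refl)
  fix n assume n: "n \<in> {1..N}"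
  let ?M = "(1 / (h n)\<^sup>2) *\<^sub>R gram (\<Sigma> n)"
  \<comment> \<open>The cyclic shift lets the channel matrix act first on the column, where it is
    just a scalar.\<close>
  have "trace (?M ** resolvent G (h n)) = trace (resolvent G (h n) ** ?M)"
    by (rule trace_mul_sym)
  also have "\<dots> = (\<Sum>d\<in>UNIV. column d P \<bullet> (resolvent G (h n) *v (?M *v column d P)))"
    by (simp only: trace_orthonormal_columns[OF P] matrix_vector_mul_assoc)
  also have "\<dots> = (\<Sum>d\<in>UNIV. 1 / (h n)\<^sup>2 * l n d * (column d P \<bullet> (resolvent G (h n) *v column d P)))"
    by (simp add: scaleR_matrix_vector_assoc[symmetric] l[OF n] matrix_vector_mult_scaleR)
  finally show "trace (?M ** resolvent G (h n)) = \<dots>" .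
qed

text \<open>Turns the trace constraint on an arbitrary matrix into the budget constraint of the
  scalar problem.\<close>

lemma trace_gram_columns:
  fixes G P :: "real^'y^'y"
  assumes "orthogonal_matrix P"
  shows "trace (transpose G ** G) = (\<Sum>d\<in>UNIV. (norm (G *v column d P))\<^sup>2)"
  by (simp only: trace_orthonormal_columns[OF assms] gram_def[symmetric] inner_gram power2_norm_eq_inner)

theorem theorem2:
  fixes N :: nat and h :: "nat \<Rightarrow> real" and \<Sigma> :: "nat \<Rightarrow> real^'y^'x" and E :: real
    and S :: "(real^'y) set" and Sn :: "nat \<Rightarrow> (real^'y) set" and P :: "real^'y^'y"
  assumes "N \<ge> 1" and "\<forall>n\<in>{1..N}. h n \<noteq> 0" and "E > 0"
    and "positive_eigenbasis (\<Sum>n=1..N. gram (\<Sigma> n)) S"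
    and "\<forall>n\<in>{1..N}. positive_eigenbasis (gram (\<Sigma> n)) (Sn n)"
    and "\<forall>n\<in>{1..N}. Sn n \<subseteq> S"
    and "orthogonal_matrix P"
    and "\<forall>d. \<exists>\<mu>. eigenvector (\<Sum>n=1..N. gram (\<Sigma> n)) \<mu> (column d P)"
    and "S \<subseteq> columns P"
  shows "\<exists>\<beta>>0. \<exists>w::real^'y. (\<forall>d. w $ d \<ge> 0) \<and>
           first_order_condition N h \<Sigma> \<beta> (sqrt_diag_matrix w ** transpose P) \<and>
           local_minimizer_on (mse_objective N h \<Sigma>) (feasible_set E)
             (sqrt_diag_matrix w ** transpose P)"
proof -
  note h = \<open>\<forall>n\<in>{1..N}. h n \<noteq> 0\<close>[rule_format] and P = \<open>orthogonal_matrix P\<close>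
  define c where "c n = 1 / (h n)\<^sup>2" for n
  have c: "c n > 0" if "n \<in> {1..N}" for n
    using h[OF that] by (simp add: c_def)
  \<comment> \<open>The inclusions of \<open>Sn n\<close> in \<open>S\<close> and of
    \<open>S\<close> in the columns of \<open>P\<close> let one orthonormal basis diagonalise all
    channels at once.\<close>
  have "\<forall>n\<in>{1..N}. \<forall>d. \<exists>l\<ge>0. gram (\<Sigma> n) *v column d P = l *\<^sub>R column d P"
    using assms by (intro ballI allI gram_column_eigenvector[where S = "Sn _"]) blast+
  then obtain l where l0: "\<And>n d. n \<in> {1..N} \<Longrightarrow> l n d \<ge> 0"
    and l: "\<And>n d. n \<in> {1..N} \<Longrightarrow> gram (\<Sigma> n) *v column d P = l n d *\<^sub>R column d P"
    by metis
  obtain w :: "real^'y" and \<beta> where \<beta>: "\<beta> > 0" and w0: "\<forall>d. w $ d \<ge> 0" and wE: "(\<Sum>d\<in>UNIV. w $ d) \<le> E"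
    and slack: "\<forall>d. w $ d > 0 \<longrightarrow> (\<Sum>n=1..N. c n * l n d / (w $ d + c n)\<^sup>2) = \<beta>"
    and min: "\<forall>v :: real^'y. (\<forall>d. v $ d \<ge> 0) \<and> (\<Sum>d\<in>UNIV. v $ d) \<le> E \<longrightarrow>
      (\<Sum>n=1..N. \<Sum>d\<in>UNIV. c n * l n d / (w $ d + c n)) \<le> (\<Sum>n=1..N. \<Sum>d\<in>UNIV. c n * l n d / (v $ d + c n))"
    by (rule water_filling[of "{1..N}" E c l, OF finite_atLeastAtMost \<open>E > 0\<close> c l0])
      (assumption | (rule that; assumption))+
  note w = w0[rule_format] wE
  define G where "G = sqrt_diag_matrix w ** transpose P"
  have resolvent_col: "resolvent G (h n) *v column d P = (1 / (w $ d + c n)) *\<^sub>R column d P"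
    if "n \<in> {1..N}" for n d
    unfolding G_def c_def using gram_sqrt_diag_column[OF P w(1)] w(1) h[OF that]
    by (intro resolvent_eigenvector)
  have G_col: "G *v column d P = sqrt (w $ d) *\<^sub>R axis d 1" for d
    unfolding G_def by (rule sqrt_diag_transpose_column[OF P])
  have objective: "mse_objective N h \<Sigma> G' =
      (\<Sum>n=1..N. \<Sum>d\<in>UNIV. 1 / (h n)\<^sup>2 * l n d * (column d P \<bullet> (resolvent G' (h n) *v column d P)))" for G'
    by (rule mse_objective_eigencolumns[OF P]) (rule l)
  have "first_order_condition N h \<Sigma> \<beta> G"
    unfolding first_order_condition_def
  \<comment> \<open>On each column every factor to the right of \<open>G\<close> acts as a scalar,
    so the matrix equation splits into one scalar equation per column.\<close>
  proof (rule matrix_eqI_columns[OF P])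
    fix d
    have summand: "(G ** resolvent G (h n) ** ((1 / (h n)\<^sup>2) *\<^sub>R gram (\<Sigma> n)) ** resolvent G (h n)) *v column d P
        = (c n * l n d / (w $ d + c n)\<^sup>2) *\<^sub>R (G *v column d P)" if "n \<in> {1..N}" for n
      by (simp add: matrix_vector_mul_assoc[symmetric] resolvent_col[OF that] l[OF that]
          scaleR_matrix_vector_assoc[symmetric] matrix_vector_mult_scaleR c_def power2_eq_square)
    have "(\<Sum>n=1..N. G ** resolvent G (h n) ** ((1 / (h n)\<^sup>2) *\<^sub>R gram (\<Sigma> n)) ** resolvent G (h n)) *v column d P
        = (\<Sum>n=1..N. (G ** resolvent G (h n) ** ((1 / (h n)\<^sup>2) *\<^sub>R gram (\<Sigma> n)) ** resolvent G (h n)) *v column d P)"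
      by (rule linear_sum[of "\<lambda>A. A *v column d P", unfolded o_def])
        (intro linearI; simp add: matrix_vector_mult_add_rdistrib scaleR_matrix_vector_assoc)
    also have "\<dots> = (\<Sum>n=1..N. c n * l n d / (w $ d + c n)\<^sup>2) *\<^sub>R (G *v column d P)"
      by (simp add: summand scaleR_sum_left)
    \<comment> \<open>For an inactive coordinate both sides vanish because \<open>G\<close> kills
      the column; for an active one this is the multiplier equation.\<close>
    also have "\<dots> = \<beta> *\<^sub>R (G *v column d P)"
      using slack[rule_format, of d] w(1)[of d] by (cases "w $ d = 0") (auto simp: G_col)
    finally show "(\<Sum>n=1..N. G ** resolvent G (h n) ** ((1 / (h n)\<^sup>2) *\<^sub>R gram (\<Sigma> n)) ** resolvent G (h n)) *v column d P
        = (\<beta> *\<^sub>R G) *v column d P"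
      by (simp add: scaleR_matrix_vector_assoc)
  qed
  moreover have "G \<in> feasible_set E"
    using w by (simp add: feasible_set_def trace_gram_columns[OF P] G_col norm_axis_1)
  moreover have "mse_objective N h \<Sigma> G \<le> mse_objective N h \<Sigma> G'" if "G' \<in> feasible_set E" for G'
  proof -
    \<comment> \<open>The powers that the competitor \<open>G'\<close> spends on the columns form a
      feasible point of the scalar problem.\<close>
    define v :: "real^'y" where "v = (\<chi> d. (norm (G' *v column d P))\<^sup>2)"
    have "mse_objective N h \<Sigma> G = (\<Sum>n=1..N. \<Sum>d\<in>UNIV. c n * l n d / (w $ d + c n))"
      by (simp add: objective resolvent_col orthogonal_matrix_inner_columns[OF P] c_def)
    also have "\<dots> \<le> (\<Sum>n=1..N. \<Sum>d\<in>UNIV. c n * l n d / (v $ d + c n))"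
      using that by (intro min[rule_format] conjI allI) (simp_all add: v_def feasible_set_def trace_gram_columns[OF P])
    \<comment> \<open>Termwise resolvent bound, weighted by the nonnegative
      \<open>c n * l n d\<close>. For \<open>G\<close> itself the corresponding relation was an
      equality.\<close>
    also have "\<dots> \<le> mse_objective N h \<Sigma> G'"
      unfolding objective
    proof (intro sum_mono)
      fix n d assume n: "n \<in> {1..N}"
      have "1 / (v $ d + c n) \<le> column d P \<bullet> (resolvent G' (h n) *v column d P)"
        unfolding v_def c_def vec_lambda_beta using h[OF n] P
        by (intro inner_resolvent_ge) (auto simp: orthogonal_matrix_orthonormal_columns)
      then have "c n * l n d * (1 / (v $ d + c n))
          \<le> c n * l n d * (column d P \<bullet> (resolvent G' (h n) *v column d P))"
        using c[OF n] l0[OF n] by (intro mult_left_mono) auto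
      then show "c n * l n d / (v $ d + c n)
          \<le> 1 / (h n)\<^sup>2 * l n d * (column d P \<bullet> (resolvent G' (h n) *v column d P))"
        by (simp add: c_def)
    qed
    finally show ?thesis .
  qed
  ultimately show ?thesis
    \<comment> \<open>The inequality holds on the whole feasible set, so radius 1 serves as well as
      any other.\<close>
    unfolding local_minimizer_on_def G_def using \<beta> w(1) by (metis zero_less_one)
qed

end
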